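(* As formal power series in $x$, $$c_1^5e^{\alpha x}+c_2^5e^{\beta x}+c_3^5e^{\gamma x}=\frac{1}{968}\sum_{n=0}^\infty T_n^{(5,6,15)}\frac{x^n}{n!}.$$
   Context: Let $\alpha,\beta,\gamma$ be the three distinct complex roots of $x^3-x^2-x-1=0$, and set $c_1=\frac{\alpha}{(\alpha-\beta)(\alpha-\gamma)}$, $c_2=\frac{\beta}{(\beta-\alpha)(\beta-\gamma)}$, $c_3=\frac{\gamma}{(\gamma-\alpha)(\gamma-\beta)}$. For numbers $s_0,s_1,s_2$, the sequence $T_n^{(s_0,s_1,s_2)}$ is defined by $T_0^{(s_0,s_1,s_2)}=s_0$, $T_1^{(s_0,s_1,s_2)}=s_1$, $T_2^{(s_0,s_1,s_2)}=s_2$ and $T_n^{(s_0,s_1,s_2)}=T_{n-1}^{(s_0,s_1,s_2)}+T_{n-2}^{(s_0,s_1,s_2)}+T_{n-3}^{(s_0,s_1,s_2)}$ for $n\ge3$. *)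

theory Defs
  imports Complex_Main "HOL-Computational_Algebra.Formal_Power_Series"
begin

fun tribonacci :: "'a::plus \<Rightarrow> 'a \<Rightarrow> 'a \<Rightarrow> nat \<Rightarrow> 'a" where
  "tribonacci s0 s1 s2 0 = s0"
| "tribonacci s0 s1 s2 (Suc 0) = s1"
| "tribonacci s0 s1 s2 (Suc (Suc 0)) = s2"
| "tribonacci s0 s1 s2 (Suc (Suc (Suc n))) =
     tribonacci s0 s1 s2 (Suc (Suc n)) + tribonacci s0 s1 s2 (Suc n) + tribonacci s0 s1 s2 n"

end

theory Submission
  imports Defs
begin

text \<open>
  For a root z of f(x) = x^3 - x^2 - x - 1, the product of the differences with the other two
  roots is f'(z) = 3 z^2 - 2 z - 1, so each c_i is the same rational function of its root. Inverting
  f'(z) in Q[x]/(f) and reducing modulo f gives c_i^5 = (25 + 38 z - z^2) / 21296. Hence the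
  coefficients of x^n/n! on both sides satisfy the tribonacci recurrence, and the three
  initial values are rational combinations of power sums of the roots.
\<close>

lemma tribonacci_eqI:
  fixes u :: "nat \<Rightarrow> 'a::plus"
  assumes "u 0 = s0" "u 1 = s1" "u 2 = s2"
    and rec: "\<And>n. u (Suc (Suc (Suc n))) = u (Suc (Suc n)) + u (Suc n) + u n"
  shows "u n = tribonacci s0 s1 s2 n"
  using assms by (induction s0 s1 s2 n rule: tribonacci.induct) (simp_all add: numeral_2_eq_2)

text \<open>Subtracting the cubic equations of two roots and cancelling their nonzero difference
  leaves a quadratic relation. Subtracting two such relations and cancelling again leaves the linear
  one, so Vieta's formulas follow from the distinct roots without factoring the cubic.\<close>

lemma tribonacci_roots_sum:
  fixes a b c :: "'a::idom"
  assumes a: "a ^ 3 - a ^ 2 - a - 1 = 0" and b: "b ^ 3 - b ^ 2 - b - 1 = 0"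
    and c: "c ^ 3 - c ^ 2 - c - 1 = 0"
    and distinct: "a \<noteq> b" "a \<noteq> c" "b \<noteq> c"
  shows "a + b + c = 1" and "a * b + a * c + b * c = -1"
proof -
  have "(a - b) * (a ^ 2 + a * b + b ^ 2 - a - b - 1) = 0"
    using a b by algebra
  hence ab: "a ^ 2 + a * b + b ^ 2 - a - b - 1 = 0"
    using distinct by simp
  have "(a - c) * (a ^ 2 + a * c + c ^ 2 - a - c - 1) = 0"
    using a c by algebra
  hence ac: "a ^ 2 + a * c + c ^ 2 - a - c - 1 = 0"
    using distinct by simp
  have "(b - c) * (a + b + c - 1) = 0"
    using ab ac by algebra
  thus sum: "a + b + c = 1"
    using distinct by simp
  show "a * b + a * c + b * c = -1"
    using ab sum by algebra
qed

text \<open>Going through \<open>c\<close>, \<open>c ^ 2\<close>, \<open>c ^ 4\<close> means that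
  each step only multiplies two quadratics in \<open>z\<close> and reduces modulo the cubic.\<close>

lemma tribonacci_coeff_power5:
  fixes z c :: "'a::field_char_0"
  assumes z: "z ^ 3 - z ^ 2 - z - 1 = 0" and c: "c * (3 * z ^ 2 - 2 * z - 1) = z"
  shows "c ^ 5 = (25 + 38 * z - z ^ 2) / 21296"
proof -
  \<comment> \<open>Modulo the cubic,
    \<open>(3 * z ^ 2 - 2 * z - 1) * (1 + 9 * z - 4 * z ^ 2)\<close> is 22, so multiplying the
    hypothesis on \<open>c\<close> by the second factor isolates \<open>22 * c\<close>.\<close>
  have "22 * c = 5 * z ^ 2 - 3 * z - 4"
    using z c by algebra
  hence c': "c = (5 * z ^ 2 - 3 * z - 4) / 22"
    by (simp add: field_simps)
  have "(5 * z ^ 2 - 3 * z - 4) ^ 2 = 11 * (1 + 4 * z - z ^ 2)"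
    using z by algebra
  hence c2: "c ^ 2 = (1 + 4 * z - z ^ 2) / 44"
    unfolding c' by (simp add: power_divide field_simps)
  have "(1 + 4 * z - z ^ 2) ^ 2 = 2 * (4 * z ^ 2 + z - 3)"
    using z by algebra
  hence c4: "(c ^ 2) ^ 2 = (4 * z ^ 2 + z - 3) / 968"
    unfolding c2 by (simp add: power_divide field_simps)
  have "(4 * z ^ 2 + z - 3) * (5 * z ^ 2 - 3 * z - 4) = 25 + 38 * z - z ^ 2"
    using z by algebra
  moreover have "c ^ 5 = (c ^ 2) ^ 2 * c"
    by algebra
  ultimately show ?thesis
    unfolding c4 unfolding c' by simp
qed

theorem lemma9:
  fixes \<alpha> \<beta> \<gamma> c1 c2 c3 :: complex
  assumes roots: "{z::complex. z ^ 3 - z ^ 2 - z - 1 = 0} = {\<alpha>, \<beta>, \<gamma>}"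
    and distinct: "\<alpha> \<noteq> \<beta>" "\<alpha> \<noteq> \<gamma>" "\<beta> \<noteq> \<gamma>"
    and c1: "c1 = \<alpha> / ((\<alpha> - \<beta>) * (\<alpha> - \<gamma>))"
    and c2: "c2 = \<beta> / ((\<beta> - \<alpha>) * (\<beta> - \<gamma>))"
    and c3: "c3 = \<gamma> / ((\<gamma> - \<alpha>) * (\<gamma> - \<beta>))"
  shows "fps_const (c1 ^ 5) * fps_exp \<alpha> + fps_const (c2 ^ 5) * fps_exp \<beta>
           + fps_const (c3 ^ 5) * fps_exp \<gamma>
         = fps_const (1 / 968) * Abs_fps (\<lambda>n. tribonacci 5 6 15 n / fact n)"
proof -
  have "\<alpha> \<in> {z. z ^ 3 - z ^ 2 - z - 1 = 0}" "\<beta> \<in> {z. z ^ 3 - z ^ 2 - z - 1 = 0}"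
    "\<gamma> \<in> {z. z ^ 3 - z ^ 2 - z - 1 = 0}"
    unfolding roots by simp_all
  hence r: "\<alpha> ^ 3 - \<alpha> ^ 2 - \<alpha> - 1 = 0" "\<beta> ^ 3 - \<beta> ^ 2 - \<beta> - 1 = 0"
    "\<gamma> ^ 3 - \<gamma> ^ 2 - \<gamma> - 1 = 0"
    by simp_all
  note e = tribonacci_roots_sum[OF r distinct]
  \<comment> \<open>Vieta's formulas express the sum and the product of the other two roots through
    the root itself.\<close>
  have "(\<alpha> - \<beta>) * (\<alpha> - \<gamma>) = 3 * \<alpha> ^ 2 - 2 * \<alpha> - 1"
    "(\<beta> - \<alpha>) * (\<beta> - \<gamma>) = 3 * \<beta> ^ 2 - 2 * \<beta> - 1"
    "(\<gamma> - \<alpha>) * (\<gamma> - \<beta>) = 3 * \<gamma> ^ 2 - 2 * \<gamma> - 1"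
    using e by algebra+
  moreover have "c1 * ((\<alpha> - \<beta>) * (\<alpha> - \<gamma>)) = \<alpha>" "c2 * ((\<beta> - \<alpha>) * (\<beta> - \<gamma>)) = \<beta>"
    "c3 * ((\<gamma> - \<alpha>) * (\<gamma> - \<beta>)) = \<gamma>"
    using distinct by (simp_all add: c1 c2 c3)
  ultimately have p: "c1 ^ 5 = (25 + 38 * \<alpha> - \<alpha> ^ 2) / 21296"
    "c2 ^ 5 = (25 + 38 * \<beta> - \<beta> ^ 2) / 21296" "c3 ^ 5 = (25 + 38 * \<gamma> - \<gamma> ^ 2) / 21296"
    using r by (simp_all add: tribonacci_coeff_power5)
  define u where "u n = 968 * (c1 ^ 5 * \<alpha> ^ n + c2 ^ 5 * \<beta> ^ n + c3 ^ 5 * \<gamma> ^ n)" for n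
  \<comment> \<open>A quadratic times \<open>z ^ n\<close> with n at most 2 needs power sums up to
    exponent 4. Summing the cubic relation over the roots gives 3 + 1 + 3 = 7, then 7 + 3 + 1 =
    11.\<close>
  have s2: "\<alpha> ^ 2 + \<beta> ^ 2 + \<gamma> ^ 2 = 3"
    using e by algebra
  have s3: "\<alpha> ^ 3 + \<beta> ^ 3 + \<gamma> ^ 3 = 7"
    using e(1) s2 r by algebra
  have s4: "\<alpha> ^ 4 + \<beta> ^ 4 + \<gamma> ^ 4 = 11"
    using e(1) s2 s3 r by algebra
  \<comment> \<open>The denominator is 21296 / 968 = 22, so the three sums evaluated next have to be
    22 times 5, 6 and 15.\<close>
  have w: "u n = ((25 + 38 * \<alpha> - \<alpha> ^ 2) * \<alpha> ^ n + (25 + 38 * \<beta> - \<beta> ^ 2) * \<beta> ^ n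
      + (25 + 38 * \<gamma> - \<gamma> ^ 2) * \<gamma> ^ n) / 22" for n
    unfolding u_def p by (simp add: field_simps)
  have "(25 + 38 * \<alpha> - \<alpha> ^ 2) + (25 + 38 * \<beta> - \<beta> ^ 2) + (25 + 38 * \<gamma> - \<gamma> ^ 2) = 110"
    "(25 + 38 * \<alpha> - \<alpha> ^ 2) * \<alpha> + (25 + 38 * \<beta> - \<beta> ^ 2) * \<beta>
      + (25 + 38 * \<gamma> - \<gamma> ^ 2) * \<gamma> = 132"
    "(25 + 38 * \<alpha> - \<alpha> ^ 2) * \<alpha> ^ 2 + (25 + 38 * \<beta> - \<beta> ^ 2) * \<beta> ^ 2
      + (25 + 38 * \<gamma> - \<gamma> ^ 2) * \<gamma> ^ 2 = 330"
    using e(1) s2 s3 s4 by algebra+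
  hence init: "u 0 = 5" "u 1 = 6" "u 2 = 15"
    unfolding w by simp_all
  have pow: "z ^ Suc (Suc (Suc n)) = z ^ Suc (Suc n) + z ^ Suc n + z ^ n"
    if "z ^ 3 - z ^ 2 - z - 1 = 0" for z :: complex and n
  proof -
    have "z ^ 3 = z ^ 2 + z + 1"
      using that by algebra
    hence "z ^ n * z ^ 3 = z ^ n * (z ^ 2 + z + 1)"
      by simp
    thus ?thesis
      by (simp add: algebra_simps power2_eq_square power3_eq_cube)
  qed
  have "u (Suc (Suc (Suc n))) = u (Suc (Suc n)) + u (Suc n) + u n" for n
    unfolding u_def pow[OF r(1)] pow[OF r(2)] pow[OF r(3)] by (simp only: ring_distribs ac_simps)
  hence "tribonacci 5 6 15 n = u n" for n
    using init by (intro tribonacci_eqI[symmetric])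
  thus ?thesis
    \<comment> \<open>Both sides have n-th coefficient \<open>u n / (968 * fact n)\<close>.\<close>
    by (intro fps_ext) (simp add: u_def add_divide_distrib)
qed

end
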